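(* Fix $p\in[\frac12,1)$, let $q:=1-p$, and let $d$ be a positive integer. Let $(S_n)_{n\ge 0}$ be the simple random walk on $\mathbb{Z}$ with $S_0=0$ and mutually independent increments $X_n=S_n-S_{n-1}$ satisfying $\mathbb{P}[X_n=+1]=p$ and $\mathbb{P}[X_n=-1]=q$ for $n\ge 1$. Let $R_n:=\#\{1\le k\le n: X_k=+1\}$ and $N_d:=\inf\{n\ge 0: S_n=d\}$. Then $$ \mathbb{E}\left[\frac{R_{N_d}}{N_d}\right] = \frac12+\frac{d}{2}\int_0^1 u^{d-1}h_p(u)\,du $$ and $$ \operatorname{Var}\left[\frac{R_{N_d}}{N_d}\right] =\frac{d^2}{4}\left\{\int_0^1 u^{d-1}h_p(u)\ell_p(u)\,du-\left(\int_0^1 u^{d-1}h_p(u)\,du\right)^2\right\}, $$ where $$ h_p(u):=\frac{p-qu^2}{p+qu^2} \quad\text{and}\quad \ell_p(u):=\ln\left(\frac{p+qu^2}{u}\right). $$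
   Context: For $p\ge \frac12$, the hitting time $N_d$ is almost surely finite, so $R_{N_d}/N_d$ is almost surely well defined (its value on the null event $\{N_d=\infty\}$ is irrelevant). $R_{N_d}$ denotes $R_n$ evaluated at $n=N_d$. *)

theory Defs
  imports "HOL-Probability.Probability" "HOL-Library.Extended_Nat"
begin

text \<open>The increment \<open>X\<^sub>n = S\<^sub>n - S\<^sub>n\<^sub>-\<^sub>1\<close> is meaningful only for \<open>n \<ge> 1\<close>
  (natural-number subtraction truncates at \<open>n = 0\<close>) and is only used there.\<close>

definition increment :: "(nat \<Rightarrow> 'w \<Rightarrow> int) \<Rightarrow> nat \<Rightarrow> 'w \<Rightarrow> int" where
  "increment S n \<omega> = S n \<omega> - S (n - 1) \<omega>"

text \<open>Measurability of the increments is part of \<open>indep_vars\<close>; that of every \<open>S n\<close> follows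
  since \<open>S 0\<close> is constant.\<close>

definition simple_random_walk :: "'w measure \<Rightarrow> real \<Rightarrow> (nat \<Rightarrow> 'w \<Rightarrow> int) \<Rightarrow> bool" where
  "simple_random_walk M p S \<longleftrightarrow>
     prob_space M \<and>
     (\<forall>\<omega>\<in>space M. S 0 \<omega> = 0) \<and>
     prob_space.indep_vars M (\<lambda>_. count_space UNIV) (increment S) {1..} \<and>
     (\<forall>n\<ge>1. measure M {\<omega>\<in>space M. increment S n \<omega> = 1} = p \<and>
             measure M {\<omega>\<in>space M. increment S n \<omega> = -1} = 1 - p)"

definition up_steps :: "(nat \<Rightarrow> 'w \<Rightarrow> int) \<Rightarrow> nat \<Rightarrow> 'w \<Rightarrow> nat" where
  "up_steps S n \<omega> = card {k. 1 \<le> k \<and> k \<le> n \<and> increment S k \<omega> = 1}"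

text \<open>The infimum is taken in \<^typ>\<open>enat\<close>, so it is \<open>\<infinity>\<close> if the level is never reached.\<close>

definition hitting_time :: "(nat \<Rightarrow> 'w \<Rightarrow> int) \<Rightarrow> int \<Rightarrow> 'w \<Rightarrow> enat" where
  "hitting_time S a \<omega> = Inf {enat n | n. S n \<omega> = a}"

text \<open>\<open>R\<^bsub>N\<^esub> / N\<close> at the hitting time \<open>N\<close> of level \<open>a\<close>; the value on the event \<open>N = \<infinity>\<close>
  is an arbitrary convention.\<close>

definition up_fraction_at_hit :: "(nat \<Rightarrow> 'w \<Rightarrow> int) \<Rightarrow> int \<Rightarrow> 'w \<Rightarrow> real" where
  "up_fraction_at_hit S a \<omega> =
     (case hitting_time S a \<omega> of enat n \<Rightarrow> real (up_steps S n \<omega>) / real n | \<infinity> \<Rightarrow> 0)"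

definition h :: "real \<Rightarrow> real \<Rightarrow> real" where
  "h p u = (p - (1 - p) * u\<^sup>2) / (p + (1 - p) * u\<^sup>2)"

definition ell :: "real \<Rightarrow> real \<Rightarrow> real" where
  "ell p u = ln ((p + (1 - p) * u\<^sup>2) / u)"

end

theory Submission
  imports Defs "HOL-Real_Asymp.Real_Asymp"
begin

text \<open>At the hitting time \<open>N\<close> of level \<open>d\<close> one has \<open>2 R\<^sub>N - N = d\<close>, so \<open>R\<^sub>N / N = 1/2 + d / (2 N)\<close> and
  only the first two moments of \<open>1/N\<close> matter. Put \<open>z(u) = u / (p + q u\<^sup>2)\<close>. Then \<open>z(u)\<^sup>n u powi (d - S\<^sub>n)\<close> is
  a martingale which is bounded up to time \<open>N\<close>, and stopping it yields \<open>E[z(u)\<^sup>N; N < \<infinity>] = u\<^sup>d\<close> for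
  \<open>0 < u < 1\<close>; letting \<open>u\<close> tend to 1 shows that \<open>N\<close> is almost surely finite. Since \<open>z'/z = h/u\<close>,
  \<open>\<ell> = - ln z\<close>, and \<open>z\<close> increases from 0 to 1, substituting \<open>z = z(u)\<close> in \<open>1/n = \<integral> z\<^sup>n\<^sup>-\<^sup>1 dz\<close> and
  \<open>1/n\<^sup>2 = \<integral> z\<^sup>n\<^sup>-\<^sup>1 (- ln z) dz\<close> over \<open>[0, 1]\<close> and taking expectations under the integral gives both moments.\<close>

section \<open>The one-step discount factor \<open>z(u) = u / (p + q u^2)\<close> and the kernels
  \<open>h\<close> and \<open>ell\<close>\<close>

definition step_discount :: "real \<Rightarrow> real \<Rightarrow> real" where
  "step_discount p u = u / (p + (1 - p) * u\<^sup>2)"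

lemma step_denominator_pos: "0 < p + (1 - p) * u\<^sup>2" if "0 < p" "p < 1" for p u :: real
  using that by (simp add: add_pos_nonneg)

lemma borel_measurable_step_discount [measurable]: "step_discount p \<in> borel_measurable borel"
  unfolding step_discount_def by measurable

lemma borel_measurable_h [measurable]: "h p \<in> borel_measurable borel"
  unfolding h_def by measurable

lemma borel_measurable_ell [measurable]: "ell p \<in> borel_measurable borel"
  unfolding ell_def by measurable

text \<open>The upper bound comes from the factorisation
  \<open>p + q u^2 - u = (1 - u) (p - q u)\<close>; the second factor is positive because
  \<open>q u < q\<close> and \<open>q \<le> p\<close> when \<open>p \<ge> 1/2\<close>.\<close>

lemma step_discount_bounds:
  assumes "1 / 2 \<le> p" "p < 1" "0 < u" "u < 1"
  shows "0 < step_discount p u" "step_discount p u < 1"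
proof -
  have D: "0 < p + (1 - p) * u\<^sup>2"
    using assms by (intro step_denominator_pos) auto
  then show "0 < step_discount p u"
    using assms by (simp add: step_discount_def)
  have "(1 - p) * u < 1 - p"
    using assms by simp
  then have "0 < (1 - u) * (p - (1 - p) * u)"
    using assms by (intro mult_pos_pos) linarith+
  also have "\<dots> = p + (1 - p) * u\<^sup>2 - u"
    by (simp add: algebra_simps power2_eq_square)
  finally show "step_discount p u < 1"
    using D by (simp add: step_discount_def)
qed

text \<open>Since \<open>p / u + (1 - p) * u\<close> is the mean of \<open>u powi (- X)\<close> for
  a single increment \<open>X\<close>, this is the martingale property over one step.\<close>

lemma step_discount_inverse_eq:
  assumes "0 < p" "p < 1" "0 < u"
  shows "step_discount p u * (p / u + (1 - p) * u) = 1"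
proof -
  have D: "0 < p + (1 - p) * u\<^sup>2"
    using assms by (intro step_denominator_pos)
  have "p / u + (1 - p) * u = (p + (1 - p) * u\<^sup>2) / u"
    using assms by (simp add: field_simps power2_eq_square)
  with D assms show ?thesis
    by (simp add: step_discount_def)
qed

text \<open>With the sign of \<open>h\<close>, \<open>z\<close> is increasing on (0, 1) and the
  integrands below are nonnegative, as both the fundamental theorem in its nonnegative form and
  Tonelli require.\<close>

lemma h_pos:
  assumes "1 / 2 \<le> p" "p < 1" "0 < u" "u < 1"
  shows "0 < h p u"
proof -
  have D: "0 < p + (1 - p) * u\<^sup>2"
    using assms by (intro step_denominator_pos) auto
  have "(1 - p) * u\<^sup>2 < 1 - p"
    using assms by (simp add: power_less_one_iff)
  then have "(1 - p) * u\<^sup>2 < p"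
    using assms by linarith
  with D show ?thesis
    by (simp add: h_def)
qed

lemma ell_eq_neg_ln_step_discount: "ell p u = - ln (step_discount p u)"
proof -
  have "(p + (1 - p) * u\<^sup>2) / u = inverse (step_discount p u)"
    by (simp add: step_discount_def)
  then show ?thesis
    by (simp add: ell_def ln_inverse)
qed

lemma ell_nonneg:
  assumes "1 / 2 \<le> p" "p < 1" "0 < u" "u < 1"
  shows "0 \<le> ell p u"
  using step_discount_bounds[OF assms] by (simp add: ell_eq_neg_ln_step_discount)

text \<open>Written as a logarithmic derivative, \<open>z' / z = h / u\<close>, so that
  differentiating \<open>z ^ n\<close> produces the same weight \<open>h / u\<close> for every
  \<open>n\<close>.\<close>

lemma DERIV_step_discount:
  assumes "0 < p" "p < 1" "0 < u"
  shows "(step_discount p has_real_derivative step_discount p u * (h p u / u)) (at u)"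
proof -
  have D: "0 < p + (1 - p) * u\<^sup>2"
    using assms by (intro step_denominator_pos)
  have "(step_discount p has_real_derivative
      (p + (1 - p) * u\<^sup>2 - u * ((1 - p) * (2 * u))) / (p + (1 - p) * u\<^sup>2)\<^sup>2) (at u)"
    unfolding step_discount_def
    by (rule derivative_eq_intros refl | use D in \<open>simp add: power2_eq_square\<close>)+
  also have "(p + (1 - p) * u\<^sup>2 - u * ((1 - p) * (2 * u))) / (p + (1 - p) * u\<^sup>2)\<^sup>2
      = step_discount p u * (h p u / u)"
  proof -
    define E where "E = p + (1 - p) * u\<^sup>2"
    have "E - u * ((1 - p) * (2 * u)) = p - (1 - p) * u\<^sup>2"
      by (simp add: E_def power2_eq_square algebra_simps)
    then show ?thesis
      using assms unfolding step_discount_def h_def E_def[symmetric] by (simp add: power2_eq_square)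
  qed
  finally show ?thesis .
qed

lemma continuous_on_step_discount: "continuous_on A (step_discount p)" if "0 < p" "p < 1"
  unfolding step_discount_def using step_denominator_pos[OF that]
  by (intro continuous_intros) (metis less_irrefl)

lemma step_discount_tendsto:
  assumes "0 < p" "p < 1"
  shows "(step_discount p \<longlongrightarrow> 0) (at_right 0)" "(step_discount p \<longlongrightarrow> 1) (at_left 1)"
proof -
  have "isCont (step_discount p) x" for x
    using continuous_on_step_discount[OF assms, of UNIV] by (simp add: continuous_on_eq_continuous_at)
  then have *: "(step_discount p \<longlongrightarrow> step_discount p x) (at x within S)" for x S
    using continuous_at_imp_continuous_at_within continuous_within by blast
  show "(step_discount p \<longlongrightarrow> 0) (at_right 0)" "(step_discount p \<longlongrightarrow> 1) (at_left 1)"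
    using *[of 0] *[of 1] by (simp_all add: step_discount_def)
qed

lemma step_discount_at_right_0:
  assumes "1 / 2 \<le> p" "p < 1"
  shows "filterlim (step_discount p) (at_right 0) (at_right 0)"
proof (rule tendsto_imp_filterlim_at_right)
  show "(step_discount p \<longlongrightarrow> 0) (at_right 0)"
    using step_discount_tendsto assms by simp
  show "\<forall>\<^sub>F u in at_right 0. 0 < step_discount p u"
    using assms step_discount_bounds(1)[of p]
    by (auto simp: eventually_at_right_field intro!: exI[of _ 1])
qed

section \<open>Integral representations of \<open>1 / n\<close> and \<open>1 / n^2\<close>\<close>

lemma power_mult_ln_tendsto_0:
  assumes "1 \<le> n"
  shows "((\<lambda>x::real. x ^ n * ln x) \<longlongrightarrow> 0) (at_right 0)"
proof -
  obtain m where m: "n = Suc m"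
    using assms by (cases n) auto
  have "((\<lambda>x::real. x * ln x) \<longlongrightarrow> 0) (at_right 0)"
    by real_asymp
  then have "((\<lambda>x::real. x ^ m * (x * ln x)) \<longlongrightarrow> 0 ^ m * 0) (at_right 0)"
    by (intro tendsto_intros)
  then show ?thesis
    by (simp add: m mult.assoc mult.left_commute)
qed

text \<open>The integrand has the antiderivative \<open>z ^ n / n\<close>, which rises from 0 to
  \<open>1 / n\<close> as \<open>u\<close> runs through (0, 1); \<open>n \<ge> 1\<close> makes the
  limit at 0 vanish.\<close>

lemma integral_step_discount_h:
  assumes p: "1 / 2 \<le> p" "p < 1" and n: "1 \<le> n"
  shows "set_integrable lborel {0<..<1} (\<lambda>u. step_discount p u ^ n * (h p u / u))"
    and "(LBINT u:{0<..<1}. step_discount p u ^ n * (h p u / u)) = 1 / real n"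
proof -
  let ?z = "step_discount p"
  let ?f = "\<lambda>u. ?z u ^ n * (h p u / u)"
  let ?F = "\<lambda>u. ?z u ^ n / real n"
  have lim: "((?F \<circ> real_of_ereal) \<longlongrightarrow> 0) (at_right (ereal 0))"
    "((?F \<circ> real_of_ereal) \<longlongrightarrow> 1 / real n) (at_left (ereal 1))"
    using p n by (auto simp: ereal_tendsto_simps intro!: tendsto_eq_intros step_discount_tendsto)
  have deriv: "DERIV ?F u :> ?f u" if "ereal 0 < ereal u" "ereal u < ereal 1" for u
  proof -
    obtain m where m: "n = Suc m"
      using n by (cases n) auto
    have "DERIV ?z u :> ?z u * (h p u / u)"
      using that p by (intro DERIV_step_discount) auto
    from DERIV_cdivide[OF DERIV_power[OF this], of n "real n"] show ?thesis
      using n by (simp add: m mult_ac)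
  qed
  have cont: "isCont ?f u" if "ereal 0 < ereal u" "ereal u < ereal 1" for u
  proof -
    have "0 < p + (1 - p) * u\<^sup>2"
      using p by (intro step_denominator_pos) auto
    then show ?thesis
      using that unfolding step_discount_def h_def
      by (intro continuous_intros) auto
  qed
  have nonneg: "AE u in lborel. ereal 0 < ereal u \<longrightarrow> ereal u < ereal 1 \<longrightarrow> 0 \<le> ?f u"
    using step_discount_bounds(1)[OF p] h_pos[OF p] by (auto intro!: AE_I2 simp: less_imp_le)
  \<comment> \<open>For a nonnegative integrand the limits of the antiderivative at the endpoints
    yield integrability together with the value.\<close>
  note ftc = interval_integral_FTC_nonneg[OF _ deriv cont nonneg lim]
  show "set_integrable lborel {0<..<1} ?f"
    using ftc(1) by simp
  show "(LBINT u:{0<..<1}. ?f u) = 1 / real n"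
    using ftc(2) by (simp add: interval_lebesgue_integral_def)
qed

text \<open>Here \<open>z ^ n / n^2 - z ^ n ln z / n\<close> is the antiderivative: as a function of
  \<open>z\<close> it has derivative \<open>- z ^ (n - 1) ln z\<close>, and it runs from 0 at
  \<open>z = 0\<close> to \<open>1 / n^2\<close> at \<open>z = 1\<close>.\<close>

lemma integral_step_discount_h_ell:
  assumes p: "1 / 2 \<le> p" "p < 1" and n: "1 \<le> n"
  shows "set_integrable lborel {0<..<1} (\<lambda>u. step_discount p u ^ n * (h p u / u * ell p u))"
    and "(LBINT u:{0<..<1}. step_discount p u ^ n * (h p u / u * ell p u)) = 1 / (real n)\<^sup>2"
proof -
  let ?z = "step_discount p"
  let ?f = "\<lambda>u. ?z u ^ n * (h p u / u * ell p u)"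
  let ?G = "\<lambda>x. x ^ n / (real n)\<^sup>2 - (x ^ n * ln x) / real n"
  let ?F = "\<lambda>u. ?G (?z u)"
  have "((\<lambda>x::real. x ^ n) \<longlongrightarrow> 0 ^ n) (at_right 0)"
    by (intro tendsto_intros)
  with n have "((\<lambda>x::real. x ^ n) \<longlongrightarrow> 0) (at_right 0)"
    by simp
  from tendsto_diff[OF tendsto_divide[OF this tendsto_const]
      tendsto_divide[OF power_mult_ln_tendsto_0[OF n] tendsto_const], of "(real n)\<^sup>2" "real n"]
  have "(?G \<longlongrightarrow> 0) (at_right 0)"
    using n by simp
  \<comment> \<open>The limit of \<open>?G\<close> is one-sided because of \<open>ln\<close>, so the
    composition uses that \<open>z\<close> approaches 0 through positive values.\<close>
  then have "(?F \<longlongrightarrow> 0) (at_right 0)"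
    by (rule filterlim_compose) (use step_discount_at_right_0[OF p] in simp)
  moreover have "(?F \<longlongrightarrow> 1 / (real n)\<^sup>2) (at_left 1)"
    using p n by (auto intro!: tendsto_eq_intros step_discount_tendsto)
  ultimately have lim: "((?F \<circ> real_of_ereal) \<longlongrightarrow> 0) (at_right (ereal 0))"
    "((?F \<circ> real_of_ereal) \<longlongrightarrow> 1 / (real n)\<^sup>2) (at_left (ereal 1))"
    by (simp_all add: ereal_tendsto_simps)
  have deriv: "DERIV ?F u :> ?f u" if "ereal 0 < ereal u" "ereal u < ereal 1" for u
  proof -
    obtain m where m: "n = Suc m"
      using n by (cases n) auto
    have z: "0 < ?z u"
      using step_discount_bounds p that by simp
    have "DERIV ?G (?z u) :> real n * ?z u ^ m / (real n)\<^sup>2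
        - (real n * ?z u ^ m * ln (?z u) + ?z u ^ n * (1 / ?z u)) / real n"
      using DERIV_diff[OF DERIV_cdivide[OF DERIV_pow]
          DERIV_cdivide[OF DERIV_mult[OF DERIV_pow DERIV_ln_divide[OF z]]],
          of n "(real n)\<^sup>2" n "real n"]
      by (simp add: m mult_ac add_ac)
    also have "real n * ?z u ^ m / (real n)\<^sup>2
        - (real n * ?z u ^ m * ln (?z u) + ?z u ^ n * (1 / ?z u)) / real n = - (?z u ^ m * ln (?z u))"
    proof -
      have "?z u ^ n * (1 / ?z u) = ?z u ^ m"
        using z by (simp add: m)
      then show ?thesis
        using n by (simp add: power2_eq_square add_divide_distrib)
    qed
    finally have "DERIV ?F u :> - (?z u ^ m * ln (?z u)) * (?z u * (h p u / u))"
      by (rule DERIV_chain2) (rule DERIV_step_discount; use that p in simp)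
    then show ?thesis
      by (simp add: m ell_eq_neg_ln_step_discount mult_ac)
  qed
  have cont: "isCont ?f u" if "ereal 0 < ereal u" "ereal u < ereal 1" for u
  proof -
    have "0 < p + (1 - p) * u\<^sup>2"
      using p by (intro step_denominator_pos) auto
    then show ?thesis
      using that unfolding step_discount_def h_def ell_def
      by (intro continuous_intros) auto
  qed
  have nonneg: "AE u in lborel. ereal 0 < ereal u \<longrightarrow> ereal u < ereal 1 \<longrightarrow> 0 \<le> ?f u"
    using step_discount_bounds(1)[OF p] h_pos[OF p] ell_nonneg[OF p]
    by (auto intro!: AE_I2 simp: less_imp_le)
  note ftc = interval_integral_FTC_nonneg[OF _ deriv cont nonneg lim]
  show "set_integrable lborel {0<..<1} ?f"
    using ftc(1) by simp
  show "(LBINT u:{0<..<1}. ?f u) = 1 / (real n)\<^sup>2"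
    using ftc(2) by (simp add: interval_lebesgue_integral_def)
qed

section \<open>The walk and its increments\<close>

locale upward_walk = prob_space M for M :: "'w measure" +
  fixes p :: real and S :: "nat \<Rightarrow> 'w \<Rightarrow> int" and d :: nat
  assumes p: "1 / 2 \<le> p" "p < 1" and d: "1 \<le> d"
    and start: "\<And>\<omega>. \<omega> \<in> space M \<Longrightarrow> S 0 \<omega> = 0"
    and indep: "indep_vars (\<lambda>_. count_space UNIV) (increment S) {1..}"
    and up: "\<And>n. 1 \<le> n \<Longrightarrow> prob {\<omega> \<in> space M. increment S n \<omega> = 1} = p"
    and down: "\<And>n. 1 \<le> n \<Longrightarrow> prob {\<omega> \<in> space M. increment S n \<omega> = -1} = 1 - p"
begin

lemma measurable_increment: "1 \<le> n \<Longrightarrow> increment S n \<in> M \<rightarrow>\<^sub>M count_space UNIV"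
  using indep by (simp add: indep_vars_def)

lemma S_eq_sum_increments: "\<omega> \<in> space M \<Longrightarrow> S n \<omega> = (\<Sum>k\<in>{1..n}. increment S k \<omega>)"
proof (induction n)
  case 0
  then show ?case by (simp add: start)
next
  case (Suc n)
  then have "S (Suc n) \<omega> = S n \<omega> + increment S (Suc n) \<omega>"
    by (simp add: increment_def)
  with Suc show ?case by simp
qed

lemma measurable_S [measurable]: "S n \<in> M \<rightarrow>\<^sub>M count_space UNIV"
proof (induction n)
  case 0
  then show ?case by (simp add: start cong: measurable_cong)
next
  case (Suc n)
  have "(\<lambda>\<omega>. S n \<omega> + increment S (Suc n) \<omega>) \<in> M \<rightarrow>\<^sub>M count_space UNIV"
    using Suc measurable_increment[of "Suc n"] by measurable
  then show ?case by (simp add: increment_def)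
qed

lemma measurable_increment' [measurable]: "increment S n \<in> M \<rightarrow>\<^sub>M count_space UNIV"
  unfolding increment_def by measurable

text \<open>The two point probabilities add up to 1, and countably many null sets are discarded at
  once.\<close>

lemma AE_increment: "AE \<omega> in M. \<forall>n\<ge>1. increment S n \<omega> = 1 \<or> increment S n \<omega> = -1"
proof -
  have "AE \<omega> in M. increment S n \<omega> = 1 \<or> increment S n \<omega> = -1" if "1 \<le> n" for n
  proof -
    have "prob {\<omega> \<in> space M. increment S n \<omega> = 1 \<or> increment S n \<omega> = -1}
        = prob ({\<omega> \<in> space M. increment S n \<omega> = 1} \<union> {\<omega> \<in> space M. increment S n \<omega> = -1})"
      by (intro arg_cong[where f = prob]) auto
    also have "\<dots> = 1"
      using up[OF that] down[OF that] by (subst finite_measure_Union) auto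
    finally show ?thesis
      by (subst (asm) prob_Collect_eq_1) auto
  qed
  then show ?thesis
    by (simp add: AE_all_countable)
qed

lemma expectation_power_increment:
  assumes "0 < u" "1 \<le> n"
  shows "integrable M (\<lambda>\<omega>. u powi (- increment S n \<omega>))"
    and "expectation (\<lambda>\<omega>. u powi (- increment S n \<omega>)) = p / u + (1 - p) * u"
proof -
  let ?A = "{\<omega> \<in> space M. increment S n \<omega> = 1}" and ?B = "{\<omega> \<in> space M. increment S n \<omega> = -1}"
  let ?g = "\<lambda>\<omega>. (1 / u) * indicator ?A \<omega> + u * indicator ?B \<omega>"
  \<comment> \<open>Off a null set the increment is 1 or -1, so the power is a two-valued simple
    function.\<close>
  have eq: "AE \<omega> in M. u powi (- increment S n \<omega>) = ?g \<omega>"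
    using AE_increment AE_space
    by eventually_elim (use assms in \<open>auto simp: indicator_def power_int_minus divide_inverse\<close>)
  have int: "integrable M ?g"
    by (intro Bochner_Integration.integrable_add integrable_mult_right integrable_real_indicator)
       (auto simp: emeasure_eq_measure)
  have meas: "(\<lambda>\<omega>. u powi (- increment S n \<omega>)) \<in> borel_measurable M"
    by measurable
  show "integrable M (\<lambda>\<omega>. u powi (- increment S n \<omega>))"
    using integrable_cong_AE[OF meas _ eq] int by (simp add: borel_measurable_integrable)
  have "expectation (\<lambda>\<omega>. u powi (- increment S n \<omega>)) = expectation ?g"
    using meas borel_measurable_integrable[OF int] eq by (rule integral_cong_AE)
  also have "\<dots> = 1 / u * prob ?A + u * prob ?B"
    by (subst Bochner_Integration.integral_add) (auto intro!: integrable_real_indicator simp: emeasure_eq_measure)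
  finally show "expectation (\<lambda>\<omega>. u powi (- increment S n \<omega>)) = p / u + (1 - p) * u"
    using up down assms by simp
qed

section \<open>The hitting time as a natural number\<close>

definition hit :: "'w \<Rightarrow> bool" where
  "hit \<omega> \<longleftrightarrow> (\<exists>n. S n \<omega> = int d)"

text \<open>On a path that never reaches the level, \<open>LEAST\<close> returns an unspecified
  number; facts about \<open>T\<close> are therefore guarded by \<open>hit\<close> or hold almost
  surely.\<close>

definition T :: "'w \<Rightarrow> nat" where
  "T \<omega> = (LEAST n. S n \<omega> = int d)"

lemma measurable_hit [measurable]: "Measurable.pred M hit"
  unfolding hit_def by measurable

lemma measurable_T [measurable]: "T \<in> M \<rightarrow>\<^sub>M count_space UNIV"
  unfolding T_def by measurable

lemma S_T: "hit \<omega> \<Longrightarrow> S (T \<omega>) \<omega> = int d"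
  unfolding T_def hit_def by (rule LeastI_ex)

lemma hitting_time_eq: "hitting_time S (int d) \<omega> = (if hit \<omega> then enat (T \<omega>) else \<infinity>)"
proof (cases "hit \<omega>")
  case True
  have "Inf {enat n |n. S n \<omega> = int d} = enat (T \<omega>)"
    using S_T[OF True] by (intro cInf_eq_minimum) (auto simp: T_def intro: Least_le)
  with True show ?thesis
    by (simp add: hitting_time_def)
next
  case False
  then have "{enat n |n. S n \<omega> = int d} = {}"
    by (auto simp: hit_def)
  with False show ?thesis
    by (simp add: hitting_time_def top_enat_def)
qed

lemma T_ge_1: "1 \<le> T \<omega>" if "\<omega> \<in> space M" "hit \<omega>"
  using S_T[OF that(2)] start[OF that(1)] d by (cases "T \<omega>") auto

section \<open>The exponential martingale stopped at level \<open>d\<close>\<close>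

definition unhit :: "nat \<Rightarrow> 'w \<Rightarrow> bool" where
  "unhit n \<omega> \<longleftrightarrow> (\<forall>k\<le>n. S k \<omega> \<noteq> int d)"

lemma measurable_unhit [measurable]: "Measurable.pred M (unhit n)"
  unfolding unhit_def by measurable

text \<open>Steps of size one cannot jump over \<open>d\<close>, and the walk starts below
  it.\<close>

lemma AE_S_less: "AE \<omega> in M. \<forall>n. unhit n \<omega> \<longrightarrow> S n \<omega> < int d"
  using AE_increment AE_space
proof eventually_elim
  case (elim \<omega>)
  show ?case
  proof (intro allI impI)
    fix n assume "unhit n \<omega>"
    then show "S n \<omega> < int d"
    proof (induction n)
      case 0
      then show ?case using start elim d by simp
    next
      case (Suc n)
      then have "unhit n \<omega>" "S (Suc n) \<omega> \<noteq> int d"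
        by (auto simp: unhit_def)
      moreover have "S (Suc n) \<omega> = S n \<omega> + 1 \<or> S (Suc n) \<omega> = S n \<omega> - 1"
        using elim(1)[rule_format, of "Suc n"] by (auto simp: increment_def)
      ultimately show ?case
        using Suc.IH by auto
    qed
  qed
qed

text \<open>The martingale \<open>z ^ n * u powi (d - S n)\<close> frozen at the hitting time, where
  the exponent of \<open>u\<close> is 0 and only \<open>z ^ T\<close> remains.\<close>

definition stopped :: "real \<Rightarrow> nat \<Rightarrow> 'w \<Rightarrow> real" where
  "stopped u n \<omega> = (if unhit n \<omega> then step_discount p u ^ n * u powi (int d - S n \<omega>)
     else step_discount p u ^ T \<omega>)"

lemma measurable_stopped [measurable]: "stopped u n \<in> borel_measurable M"
  unfolding stopped_def by measurable

text \<open>Before the hit, \<open>d - S n\<close> is positive, so the power of \<open>u\<close> is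
  at most 1. The bound 1 serves dominated convergence; the bound \<open>z ^ n\<close> forces the
  limit 0 on paths that never hit.\<close>

lemma AE_stopped_bound:
  assumes u: "0 < u" "u < 1"
  shows "AE \<omega> in M. \<forall>n. \<bar>stopped u n \<omega>\<bar> \<le> 1 \<and>
    (unhit n \<omega> \<longrightarrow> \<bar>stopped u n \<omega>\<bar> \<le> step_discount p u ^ n)"
  using AE_S_less
proof eventually_elim
  case (elim \<omega>)
  note z = step_discount_bounds[OF p u]
  have "0 \<le> u powi (int d - S n \<omega>) \<and> u powi (int d - S n \<omega>) \<le> 1" if "unhit n \<omega>" for n
  proof -
    have "0 \<le> int d - S n \<omega>"
      using elim that by (simp add: less_imp_le)
    then show ?thesis
      using u by (simp add: power_int_def power_le_one)
  qed
  with z show ?case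
    by (auto simp: stopped_def abs_mult power_le_one intro!: mult_le_one mult_left_le)
qed

lemma T_eq_Suc:
  assumes "unhit n \<omega>" "\<not> unhit (Suc n) \<omega>"
  shows "T \<omega> = Suc n" "S (Suc n) \<omega> = int d"
proof -
  show "S (Suc n) \<omega> = int d"
    using assms by (auto simp: unhit_def le_Suc_eq)
  then show "T \<omega> = Suc n"
    unfolding T_def using assms by (intro Least_equality) (auto simp: unhit_def not_less_eq_eq[symmetric])
qed

text \<open>Splits the increment of the process into a factor determined by the first
  \<open>n\<close> steps and a factor that depends on the next step alone and has mean zero.\<close>

lemma stopped_step:
  assumes "0 < u"
  shows "stopped u (Suc n) \<omega> - stopped u n \<omega> =
    (if unhit n \<omega> then step_discount p u ^ n * u powi (int d - S n \<omega>) else 0) *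
    (step_discount p u * u powi (- increment S (Suc n) \<omega>) - 1)"
proof (cases "unhit n \<omega>")
  case True
  \<comment> \<open>If the level is reached exactly at time \<open>Suc n\<close>, then
    \<open>T = Suc n\<close> and the exponent of \<open>u\<close> is 0, so the two branches of
    \<open>stopped\<close> agree.\<close>
  have "stopped u (Suc n) \<omega> = step_discount p u ^ Suc n * u powi (int d - S (Suc n) \<omega>)"
    using T_eq_Suc[OF True] by (simp add: stopped_def)
  also have "int d - S (Suc n) \<omega> = (int d - S n \<omega>) + (- increment S (Suc n) \<omega>)"
    by (simp add: increment_def)
  also have "u powi \<dots> = u powi (int d - S n \<omega>) * u powi (- increment S (Suc n) \<omega>)"
    using assms by (intro power_int_add) simp
  finally show ?thesis
    using True by (simp add: stopped_def algebra_simps)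
next
  case False
  then have "\<not> unhit (Suc n) \<omega>"
    by (auto simp: unhit_def intro: le_SucI)
  with False show ?thesis
    by (simp add: stopped_def)
qed

text \<open>The index sets \<open>{1..n}\<close> and \<open>{Suc n}\<close> are disjoint. A finite
  product of discrete spaces over the countable type \<open>int\<close> is again discrete, which
  makes every \<open>f\<close> of the past measurable.\<close>

lemma indep_past_increment:
  fixes f :: "(nat \<Rightarrow> int) \<Rightarrow> real" and g :: "int \<Rightarrow> real"
  shows "indep_var borel (\<lambda>\<omega>. f (restrict (\<lambda>k. increment S k \<omega>) {1..n}))
    borel (\<lambda>\<omega>. g (increment S (Suc n) \<omega>))"
proof -
  have *: "indep_var (PiM {1..n} (\<lambda>_. count_space UNIV)) (\<lambda>\<omega>. restrict (\<lambda>k. increment S k \<omega>) {1..n})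
      (PiM {Suc n} (\<lambda>_. count_space UNIV)) (\<lambda>\<omega>. restrict (\<lambda>k. increment S k \<omega>) {Suc n})"
    using indep by (rule indep_var_restrict) auto
  have "indep_var borel (f \<circ> (\<lambda>\<omega>. restrict (\<lambda>k. increment S k \<omega>) {1..n}))
      borel ((\<lambda>v. g (v (Suc n))) \<circ> (\<lambda>\<omega>. restrict (\<lambda>k. increment S k \<omega>) {Suc n}))"
    by (rule indep_var_compose[OF *]) (simp_all add: count_space_PiM_finite)
  then show ?thesis
    by (simp add: o_def)
qed

lemma expectation_stopped_Suc:
  assumes u: "0 < u" "u < 1"
  shows "expectation (stopped u (Suc n)) = expectation (stopped u n)"
proof -
  let ?z = "step_discount p u"
  let ?A = "\<lambda>\<omega>. if unhit n \<omega> then ?z ^ n * u powi (int d - S n \<omega>) else 0"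
  \<comment> \<open>The past factor \<open>?A\<close> as an explicit function of the vector of
    increments, with each \<open>S k\<close> replaced by a partial sum, so that independence
    applies.\<close>
  let ?f = "\<lambda>v::nat \<Rightarrow> int. if \<forall>k\<le>n. (\<Sum>j\<in>{1..k}. v j) \<noteq> int d
    then ?z ^ n * u powi (int d - (\<Sum>j\<in>{1..n}. v j)) else 0"
  let ?past = "\<lambda>\<omega>. ?f (restrict (\<lambda>k. increment S k \<omega>) {1..n})"
  let ?B = "\<lambda>\<omega>. ?z * u powi (- increment S (Suc n) \<omega>) - 1"
  have int: "integrable M (stopped u m)" for m
    using AE_stopped_bound[OF u] by (intro integrable_const_bound[of _ 1]) auto
  have past: "?past \<omega> = ?A \<omega>" if "\<omega> \<in> space M" for \<omega>
  proof -
    have "(\<Sum>j\<in>{1..k}. restrict (\<lambda>k. increment S k \<omega>) {1..n} j) = S k \<omega>" if "k \<le> n" for k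
      unfolding S_eq_sum_increments[OF \<open>\<omega> \<in> space M\<close>] using that by (intro sum.cong) auto
    then show ?thesis
      by (auto simp: unhit_def)
  qed
  have "AE \<omega> in M. \<bar>?A \<omega>\<bar> \<le> 1"
    using AE_stopped_bound[OF u] by eventually_elim (auto simp: stopped_def dest: spec[of _ n])
  then have "integrable M ?A"
    by (intro integrable_const_bound[of _ 1]) auto
  then have intA: "integrable M ?past"
    using past by (simp cong: Bochner_Integration.integrable_cong)
  note step = expectation_power_increment[of u "Suc n"]
  have intB: "integrable M ?B"
    using step u by simp
  have "expectation ?B = ?z * (p / u + (1 - p) * u) - 1"
    using step u by (simp add: prob_space)
  also have "\<dots> = 0"
    using step_discount_inverse_eq[of p u] p u by simp
  finally have B: "expectation ?B = 0" .
  have "expectation (stopped u (Suc n)) - expectation (stopped u n)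
      = expectation (\<lambda>\<omega>. stopped u (Suc n) \<omega> - stopped u n \<omega>)"
    using int by simp
  also have "\<dots> = expectation (\<lambda>\<omega>. ?past \<omega> * ?B \<omega>)"
    using past u by (intro Bochner_Integration.integral_cong) (simp_all add: stopped_step)
  also have "\<dots> = expectation ?past * expectation ?B"
    using indep_var_lebesgue_integral[OF indep_past_increment[where f = ?f
        and g = "\<lambda>x. ?z * u powi (- x) - 1"] intA intB] .
  finally show ?thesis
    using B by simp
qed

lemma expectation_stopped:
  assumes u: "0 < u" "u < 1"
  shows "expectation (stopped u n) = u ^ d"
proof (induction n)
  case 0
  have "stopped u 0 \<omega> = u ^ d" if "\<omega> \<in> space M" for \<omega>
    using start[OF that] d by (simp add: stopped_def unhit_def)
  then show ?case
    by (simp add: prob_space cong: Bochner_Integration.integral_cong)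
next
  case (Suc n)
  then show ?case
    using expectation_stopped_Suc[OF u] by simp
qed

text \<open>A path that hits makes the sequence eventually constant; on any other path it is
  dominated by \<open>z ^ n\<close>, which tends to 0 because \<open>z < 1\<close>.\<close>

lemma stopped_tendsto:
  assumes u: "0 < u" "u < 1"
  shows "AE \<omega> in M. (\<lambda>n. stopped u n \<omega>) \<longlonglongrightarrow> (if hit \<omega> then step_discount p u ^ T \<omega> else 0)"
  using AE_stopped_bound[OF u]
proof eventually_elim
  case (elim \<omega>)
  note z = step_discount_bounds[OF p u]
  show ?case
  proof (cases "hit \<omega>")
    case True
    then obtain m where m: "S m \<omega> = int d"
      by (auto simp: hit_def)
    have "\<forall>\<^sub>F n in sequentially. stopped u n \<omega> = step_discount p u ^ T \<omega>"
      using eventually_ge_at_top[of m]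
      by eventually_elim (use m in \<open>auto simp: stopped_def unhit_def\<close>)
    with True show ?thesis
      by (simp add: tendsto_eventually)
  next
    case False
    then have "unhit n \<omega>" for n
      by (auto simp: hit_def unhit_def)
    with elim have "\<bar>stopped u n \<omega>\<bar> \<le> step_discount p u ^ n" for n
      by simp
    moreover have "(\<lambda>n. step_discount p u ^ n) \<longlonglongrightarrow> 0"
      using z by (intro LIMSEQ_power_zero) simp
    ultimately have "(\<lambda>n. stopped u n \<omega>) \<longlonglongrightarrow> 0"
      by (intro Lim_null_comparison[of "\<lambda>n. stopped u n \<omega>"]) simp_all
    with False show ?thesis
      by simp
  qed
qed

section \<open>Generating function of the hitting time and almost sure finiteness\<close>

lemma expectation_discount_at_hit:
  assumes u: "0 < u" "u < 1"
  shows "expectation (\<lambda>\<omega>. if hit \<omega> then step_discount p u ^ T \<omega> else 0) = u ^ d"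
proof -
  have "(\<lambda>n. expectation (stopped u n)) \<longlonglongrightarrow>
      expectation (\<lambda>\<omega>. if hit \<omega> then step_discount p u ^ T \<omega> else 0)"
  proof (rule integral_dominated_convergence[where w = "\<lambda>_. 1"])
    show "AE \<omega> in M. norm (stopped u n \<omega>) \<le> 1" for n
      using AE_stopped_bound[OF u] by eventually_elim auto
  qed (use stopped_tendsto[OF u] in auto)
  \<comment> \<open>The expectations of the stopped process do not depend on \<open>n\<close>, so
    the limit of a constant sequence is identified.\<close>
  then have "(\<lambda>n::nat. u ^ d) \<longlonglongrightarrow>
      expectation (\<lambda>\<omega>. if hit \<omega> then step_discount p u ^ T \<omega> else 0)"
    by (simp only: expectation_stopped[OF u])
  then show ?thesis
    using LIMSEQ_unique tendsto_const by blast
qed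

text \<open>As \<open>z ^ T \<le> 1\<close>, the generating function gives
  \<open>u ^ d \<le> P(hit)\<close> for all \<open>u < 1\<close>; then \<open>u\<close> tends to
  1.\<close>

lemma AE_hit: "AE \<omega> in M. hit \<omega>"
proof -
  have "u ^ d \<le> prob {\<omega> \<in> space M. hit \<omega>}" if u: "0 < u" "u < 1" for u
  proof -
    note z = step_discount_bounds[OF p u]
    have "u ^ d = expectation (\<lambda>\<omega>. if hit \<omega> then step_discount p u ^ T \<omega> else 0)"
      using expectation_discount_at_hit[OF u] by simp
    also have "\<dots> \<le> expectation (indicator {\<omega> \<in> space M. hit \<omega>})"
    proof (rule integral_mono)
      show "integrable M (\<lambda>\<omega>. if hit \<omega> then step_discount p u ^ T \<omega> else 0)"
        using z by (intro integrable_const_bound[of _ 1]) (auto simp: power_le_one)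
    qed (use z in \<open>auto simp: power_le_one intro!: integrable_real_indicator simp: emeasure_eq_measure\<close>)
    finally show ?thesis
      by simp
  qed
  moreover have "((\<lambda>u::real. u ^ d) \<longlongrightarrow> 1) (at_left 1)"
    by (auto intro!: tendsto_eq_intros)
  ultimately have "1 \<le> prob {\<omega> \<in> space M. hit \<omega>}"
    by (intro tendsto_upperbound[where F = "at_left (1::real)" and f = "\<lambda>u. u ^ d"])
       (auto simp: eventually_at_left_field intro!: exI[of _ 0])
  then have "prob {\<omega> \<in> space M. hit \<omega>} = 1"
    using prob_le_1 antisym by blast
  then show ?thesis
    by (subst (asm) prob_Collect_eq_1) auto
qed

section \<open>Moments of \<open>1 / T\<close> by mixing over \<open>u\<close>\<close>

lemma nn_integral_discount:
  assumes u: "0 < u" "u < 1"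
  shows "(\<integral>\<^sup>+ \<omega>. ennreal (step_discount p u ^ T \<omega>) \<partial>M) = ennreal (u ^ d)"
proof -
  note z = step_discount_bounds[OF p u]
  have int: "integrable M (\<lambda>\<omega>. step_discount p u ^ T \<omega>)"
    using z by (intro integrable_const_bound[of _ 1]) (auto simp: power_le_one)
  have "expectation (\<lambda>\<omega>. step_discount p u ^ T \<omega>) = u ^ d"
    unfolding expectation_discount_at_hit[OF u, symmetric]
    using AE_hit by (intro integral_cong_AE) auto
  with int z show ?thesis
    by (subst nn_integral_eq_integral) (auto intro!: AE_I2)
qed

text \<open>If \<open>c n\<close> is the integral of \<open>z(u) ^ n\<close> against a weight
  \<open>w\<close>, Tonelli moves the expectation inside, where it turns \<open>z(u) ^ T\<close>
  into \<open>u ^ d\<close>. Boundedness of \<open>c\<close> makes the expectation finite, and this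
  finiteness passes to the integral over \<open>u\<close>.\<close>

lemma expectation_of_mixture:
  fixes w :: "real \<Rightarrow> real" and c :: "nat \<Rightarrow> real"
  assumes [measurable]: "w \<in> borel_measurable borel"
    and w: "\<And>u. 0 < u \<Longrightarrow> u < 1 \<Longrightarrow> 0 \<le> w u"
    and int: "\<And>n. 1 \<le> n \<Longrightarrow> set_integrable lborel {0<..<1} (\<lambda>u. step_discount p u ^ n * w u)"
    and c: "\<And>n. 1 \<le> n \<Longrightarrow> (LBINT u:{0<..<1}. step_discount p u ^ n * w u) = c n"
    and c_le: "\<And>n. 1 \<le> n \<Longrightarrow> 0 \<le> c n \<and> c n \<le> 1"
  shows "integrable M (\<lambda>\<omega>. c (T \<omega>))"
    and "set_integrable lborel {0<..<1} (\<lambda>u. u ^ d * w u)"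
    and "expectation (\<lambda>\<omega>. c (T \<omega>)) = (LBINT u:{0<..<1}. u ^ d * w u)"
proof -
  let ?I = "indicator {0<..<1::real} :: real \<Rightarrow> real"
  \<comment> \<open>The representation of \<open>c n\<close> is available for
    \<open>n \<ge> 1\<close> only.\<close>
  have T: "AE \<omega> in M. 1 \<le> T \<omega>"
    using AE_hit AE_space by eventually_elim (rule T_ge_1)
  have z: "0 < u \<Longrightarrow> u < 1 \<Longrightarrow> 0 \<le> step_discount p u" for u
    using step_discount_bounds[OF p] less_imp_le by blast
  show intc: "integrable M (\<lambda>\<omega>. c (T \<omega>))"
    using T c_le by (intro integrable_const_bound[of _ 1]) auto
  have nonneg: "AE \<omega> in M. 0 \<le> c (T \<omega>)"
    using T by eventually_elim (use c_le in auto)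
  then have E_nonneg: "0 \<le> expectation (\<lambda>\<omega>. c (T \<omega>))"
    by (rule integral_nonneg_AE)
  have eq: "ennreal (c n) = (\<integral>\<^sup>+ u. ennreal (?I u * (step_discount p u ^ n * w u)) \<partial>lborel)" if "1 \<le> n" for n
    using int[OF that] c[OF that] w z unfolding set_integrable_def set_lebesgue_integral_def
    by (subst nn_integral_eq_integral) (auto intro!: AE_I2 simp: indicator_def)
  have meas: "(\<lambda>(\<omega>, u). ennreal (?I u * (step_discount p u ^ T \<omega> * w u))) \<in> borel_measurable (M \<Otimes>\<^sub>M lborel)"
    by measurable
  interpret pair_sigma_finite M lborel ..
  have "ennreal (expectation (\<lambda>\<omega>. c (T \<omega>))) = (\<integral>\<^sup>+ \<omega>. ennreal (c (T \<omega>)) \<partial>M)"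
    using intc nonneg by (subst nn_integral_eq_integral) auto
  also have "\<dots> = (\<integral>\<^sup>+ \<omega>. (\<integral>\<^sup>+ u. ennreal (?I u * (step_discount p u ^ T \<omega> * w u)) \<partial>lborel) \<partial>M)"
    using T by (intro nn_integral_cong_AE) (auto simp: eq)
  also have "\<dots> = (\<integral>\<^sup>+ u. (\<integral>\<^sup>+ \<omega>. ennreal (?I u * (step_discount p u ^ T \<omega> * w u)) \<partial>M) \<partial>lborel)"
    using meas by (rule Fubini'[symmetric])
  also have "\<dots> = (\<integral>\<^sup>+ u. ennreal (?I u * (u ^ d * w u)) \<partial>lborel)"
  proof (intro nn_integral_cong)
    fix u :: real
    show "(\<integral>\<^sup>+ \<omega>. ennreal (?I u * (step_discount p u ^ T \<omega> * w u)) \<partial>M) = ennreal (?I u * (u ^ d * w u))"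
    proof (cases "0 < u \<and> u < 1")
      case True
      have "(\<integral>\<^sup>+ \<omega>. ennreal (?I u * (step_discount p u ^ T \<omega> * w u)) \<partial>M)
          = (\<integral>\<^sup>+ \<omega>. ennreal (step_discount p u ^ T \<omega>) * ennreal (w u) \<partial>M)"
        using True w z by (simp add: ennreal_mult)
      also have "\<dots> = ennreal (u ^ d) * ennreal (w u)"
        using True by (simp add: nn_integral_multc nn_integral_discount)
      also have "\<dots> = ennreal (?I u * (u ^ d * w u))"
        using True w by (simp add: ennreal_mult)
      finally show ?thesis .
    qed simp
  qed
  finally have "(\<integral>\<^sup>+ u. ennreal (?I u * (u ^ d * w u)) \<partial>lborel) = ennreal (expectation (\<lambda>\<omega>. c (T \<omega>)))"
    by simp
  then have "integrable lborel (\<lambda>u. ?I u * (u ^ d * w u)) \<and>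
      (LINT u|lborel. ?I u * (u ^ d * w u)) = expectation (\<lambda>\<omega>. c (T \<omega>))"
    by (subst (asm) nn_integral_eq_integrable) (use E_nonneg w in \<open>auto intro!: AE_I2 simp: indicator_def\<close>)
  then show "set_integrable lborel {0<..<1} (\<lambda>u. u ^ d * w u)"
    and "expectation (\<lambda>\<omega>. c (T \<omega>)) = (LBINT u:{0<..<1}. u ^ d * w u)"
    by (simp_all add: set_integrable_def set_lebesgue_integral_def)
qed

section \<open>The proportion of up-steps at the hitting time\<close>

lemma up_steps_eq_sum: "real (up_steps S n \<omega>) = (\<Sum>k\<in>{1..n}. of_bool (increment S k \<omega> = 1))"
proof -
  have "{k. 1 \<le> k \<and> k \<le> n \<and> increment S k \<omega> = 1} = {1..n} \<inter> {k. increment S k \<omega> = 1}"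
    by auto
  then show ?thesis
    unfolding up_steps_def by simp
qed

text \<open>An increment \<open>X\<close> in {1, -1} equals \<open>2 * of_bool (X = 1) - 1\<close>;
  summing up to the hitting time gives \<open>d = 2 R - N\<close>.\<close>

lemma AE_up_fraction_eq:
  "AE \<omega> in M. up_fraction_at_hit S (int d) \<omega> = 1 / 2 + real d / 2 * (1 / real (T \<omega>))"
  using AE_increment AE_hit AE_space
proof eventually_elim
  case (elim \<omega>)
  define n where "n = T \<omega>"
  have S: "S n \<omega> = int d"
    unfolding n_def using elim(2) by (rule S_T)
  have n: "1 \<le> n"
    using T_ge_1 elim n_def by simp
  have "real d = (\<Sum>k\<in>{1..n}. real_of_int (increment S k \<omega>))"
    using S S_eq_sum_increments[OF elim(3), of n] by (metis of_int_of_nat_eq of_int_sum)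
  also have "\<dots> = (\<Sum>k\<in>{1..n}. 2 * of_bool (increment S k \<omega> = 1) - 1)"
    using elim(1) by (intro sum.cong) auto
  also have "\<dots> = 2 * real (up_steps S n \<omega>) - real n"
    by (simp add: sum_subtractf sum_distrib_left[symmetric] up_steps_eq_sum)
  finally have "real (up_steps S n \<omega>) = (real n + real d) / 2"
    by simp
  then show ?case
    using n elim by (simp add: up_fraction_at_hit_def hitting_time_eq n_def[symmetric] field_simps)
qed

lemma measurable_up_fraction [measurable]:
  "up_fraction_at_hit S (int d) \<in> borel_measurable M"
proof -
  have [measurable]: "(\<lambda>\<omega>. real (up_steps S n \<omega>)) \<in> borel_measurable M" for n
    by (simp add: up_steps_eq_sum of_bool_def)
  \<comment> \<open>The random index takes countably many values, which reduces the claim to fixed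
    \<open>n\<close>.\<close>
  have [measurable]: "(\<lambda>\<omega>. real (up_steps S (T \<omega>) \<omega>)) \<in> borel_measurable M"
    by (rule measurable_compose_countable) measurable
  have "up_fraction_at_hit S (int d)
      = (\<lambda>\<omega>. if hit \<omega> then real (up_steps S (T \<omega>) \<omega>) / real (T \<omega>) else 0)"
    by (auto simp: up_fraction_at_hit_def hitting_time_eq)
  then show ?thesis
    by simp
qed

lemma moments_of_inverse_T:
  shows "integrable M (\<lambda>\<omega>. 1 / real (T \<omega>))"
    and "integrable M (\<lambda>\<omega>. 1 / (real (T \<omega>))\<^sup>2)"
    and "interval_lebesgue_integrable lborel 0 1 (\<lambda>u. u ^ (d - 1) * h p u)"
    and "interval_lebesgue_integrable lborel 0 1 (\<lambda>u. u ^ (d - 1) * h p u * ell p u)"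
    and "expectation (\<lambda>\<omega>. 1 / real (T \<omega>)) = (LBINT u=0..1. u ^ (d - 1) * h p u)"
    and "expectation (\<lambda>\<omega>. 1 / (real (T \<omega>))\<^sup>2) = (LBINT u=0..1. u ^ (d - 1) * h p u * ell p u)"
proof -
  \<comment> \<open>The interval integral runs over the open interval, so integrands have to agree
    for \<open>u > 0\<close> only and division by \<open>u\<close> is harmless.\<close>
  have ei: "einterval 0 1 = {0<..<1::real}"
    by (simp add: zero_ereal_def one_ereal_def)
  have pow: "u ^ d * (x / u) = u ^ (d - 1) * x" if "0 < u" for u x :: real
    using that d by (cases d) auto
  have cong: "set_integrable lborel {0<..<1} f \<longleftrightarrow> interval_lebesgue_integrable lborel 0 1 g"
    "(LBINT u:{0<..<1}. f u) = (LBINT u=0..1. g u)"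
    if "\<And>u. 0 < u \<Longrightarrow> f u = g u" for f g :: "real \<Rightarrow> real"
    unfolding interval_lebesgue_integrable_def interval_lebesgue_integral_def ei
    using that by (simp_all cong: conj_cong) (intro set_integrable_cong refl set_lebesgue_integral_cong; simp)+
  have int1: "set_integrable lborel {0<..<1} (\<lambda>u. u ^ d * (h p u / u)) \<longleftrightarrow>
      interval_lebesgue_integrable lborel 0 1 (\<lambda>u. u ^ (d - 1) * h p u)"
    "(LBINT u:{0<..<1}. u ^ d * (h p u / u)) = (LBINT u=0..1. u ^ (d - 1) * h p u)"
    by (rule cong, erule pow)+
  have pow_ell: "u ^ d * (h p u / u * ell p u) = u ^ (d - 1) * h p u * ell p u" if "0 < u" for u
    unfolding pow[OF that, symmetric] by simp
  have int2: "set_integrable lborel {0<..<1} (\<lambda>u. u ^ d * (h p u / u * ell p u)) \<longleftrightarrow>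
      interval_lebesgue_integrable lborel 0 1 (\<lambda>u. u ^ (d - 1) * h p u * ell p u)"
    "(LBINT u:{0<..<1}. u ^ d * (h p u / u * ell p u)) = (LBINT u=0..1. u ^ (d - 1) * h p u * ell p u)"
    by (rule cong, erule pow_ell)+
  note h = h_pos[OF p, THEN less_imp_le] and ell = ell_nonneg[OF p]
  \<comment> \<open>The weight is \<open>h / u\<close>, the logarithmic derivative of
    \<open>z\<close>; its denominator lowers \<open>u ^ d\<close> to
    \<open>u ^ (d - 1)\<close>.\<close>
  have mix1: "integrable M (\<lambda>\<omega>. 1 / real (T \<omega>))"
    "set_integrable lborel {0<..<1} (\<lambda>u. u ^ d * (h p u / u))"
    "expectation (\<lambda>\<omega>. 1 / real (T \<omega>)) = (LBINT u:{0<..<1}. u ^ d * (h p u / u))"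
    by (rule expectation_of_mixture[where c = "\<lambda>n. 1 / real n", OF _ _ integral_step_discount_h[OF p]];
        use h in auto)+
  have mix2: "integrable M (\<lambda>\<omega>. 1 / (real (T \<omega>))\<^sup>2)"
    "set_integrable lborel {0<..<1} (\<lambda>u. u ^ d * (h p u / u * ell p u))"
    "expectation (\<lambda>\<omega>. 1 / (real (T \<omega>))\<^sup>2) = (LBINT u:{0<..<1}. u ^ d * (h p u / u * ell p u))"
    by (rule expectation_of_mixture[where c = "\<lambda>n. 1 / (real n)\<^sup>2", OF _ _ integral_step_discount_h_ell[OF p]];
        use h ell in auto)+
  show "integrable M (\<lambda>\<omega>. 1 / real (T \<omega>))"
    "integrable M (\<lambda>\<omega>. 1 / (real (T \<omega>))\<^sup>2)"
    "interval_lebesgue_integrable lborel 0 1 (\<lambda>u. u ^ (d - 1) * h p u)"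
    "interval_lebesgue_integrable lborel 0 1 (\<lambda>u. u ^ (d - 1) * h p u * ell p u)"
    "expectation (\<lambda>\<omega>. 1 / real (T \<omega>)) = (LBINT u=0..1. u ^ (d - 1) * h p u)"
    "expectation (\<lambda>\<omega>. 1 / (real (T \<omega>))\<^sup>2) = (LBINT u=0..1. u ^ (d - 1) * h p u * ell p u)"
    using mix1 mix2 by (simp_all only: int1 int2)
qed

text \<open>Almost surely the proportion is an affine function of \<open>1 / T\<close> with slope
  \<open>d / 2\<close>, so the variance of \<open>1 / T\<close> is scaled by \<open>d^2 / 4\<close>
  and the shift \<open>1 / 2\<close> cancels.\<close>

lemma up_fraction_moments:
  shows "integrable M (up_fraction_at_hit S (int d))"
    and "integrable M (\<lambda>\<omega>. (up_fraction_at_hit S (int d) \<omega>)\<^sup>2)"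
    and "expectation (up_fraction_at_hit S (int d)) =
      1 / 2 + real d / 2 * expectation (\<lambda>\<omega>. 1 / real (T \<omega>))"
    and "variance (up_fraction_at_hit S (int d)) = (real d)\<^sup>2 / 4 *
      (expectation (\<lambda>\<omega>. 1 / (real (T \<omega>))\<^sup>2) - (expectation (\<lambda>\<omega>. 1 / real (T \<omega>)))\<^sup>2)"
proof -
  let ?U = "up_fraction_at_hit S (int d)"
  let ?A = "1 / 2 :: real" and ?B = "real d / 2"
  let ?V = "\<lambda>\<omega>. ?A + ?B * (1 / real (T \<omega>))"
  let ?V2 = "\<lambda>\<omega>. ?A\<^sup>2 + (2 * ?A * ?B * (1 / real (T \<omega>)) + ?B\<^sup>2 * (1 / (real (T \<omega>))\<^sup>2))"
  note int = moments_of_inverse_T(1,2)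
  have sq: "AE \<omega> in M. (?U \<omega>)\<^sup>2 = ?V2 \<omega>"
    using AE_up_fraction_eq by eventually_elim (simp add: power2_eq_square algebra_simps)
  show intU: "integrable M ?U"
    by (subst integrable_cong_AE[OF _ _ AE_up_fraction_eq])
       (use int in \<open>simp_all only: Bochner_Integration.integrable_add integrable_const integrable_mult_right
          borel_measurable_integrable measurable_up_fraction\<close>)
  show intU2: "integrable M (\<lambda>\<omega>. (?U \<omega>)\<^sup>2)"
    by (subst integrable_cong_AE[OF _ _ sq])
       (use int in \<open>simp_all only: Bochner_Integration.integrable_add integrable_const integrable_mult_right
          borel_measurable_integrable measurable_up_fraction borel_measurable_power\<close>)
  have "expectation ?U = expectation ?V"
    by (rule integral_cong_AE[OF _ _ AE_up_fraction_eq]) measurable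
  also have "\<dots> = ?A + ?B * expectation (\<lambda>\<omega>. 1 / real (T \<omega>))"
    using int(1) by (simp only: Bochner_Integration.integral_add integrable_const integrable_mult_right
        integral_mult_right_zero) (simp add: prob_space)
  finally show E: "expectation ?U = ?A + ?B * expectation (\<lambda>\<omega>. 1 / real (T \<omega>))" .
  have "expectation (\<lambda>\<omega>. (?U \<omega>)\<^sup>2) = expectation ?V2"
    by (rule integral_cong_AE[OF _ _ sq]) measurable
  also have "\<dots> = ?A\<^sup>2 + (2 * ?A * ?B * expectation (\<lambda>\<omega>. 1 / real (T \<omega>))
      + ?B\<^sup>2 * expectation (\<lambda>\<omega>. 1 / (real (T \<omega>))\<^sup>2))"
    using int by (simp only: Bochner_Integration.integral_add integrable_const integrable_mult_right
        Bochner_Integration.integrable_add integral_mult_right_zero) (simp add: prob_space)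
  finally have E2: "expectation (\<lambda>\<omega>. (?U \<omega>)\<^sup>2) = ?A\<^sup>2 +
      (2 * ?A * ?B * expectation (\<lambda>\<omega>. 1 / real (T \<omega>)) + ?B\<^sup>2 * expectation (\<lambda>\<omega>. 1 / (real (T \<omega>))\<^sup>2))" .
  show "variance ?U = (real d)\<^sup>2 / 4 *
      (expectation (\<lambda>\<omega>. 1 / (real (T \<omega>))\<^sup>2) - (expectation (\<lambda>\<omega>. 1 / real (T \<omega>)))\<^sup>2)"
    unfolding variance_eq[OF intU intU2] unfolding E E2 by (simp add: power2_eq_square field_simps)
qed

end

theorem theorem2p1:
  fixes M :: "'w measure" and S :: "nat \<Rightarrow> 'w \<Rightarrow> int" and p :: real and d :: nat
  assumes "1 / 2 \<le> p" and "p < 1" and "d \<ge> 1"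
    and "simple_random_walk M p S"
  shows "(AE \<omega> in M. hitting_time S (int d) \<omega> \<noteq> \<infinity>) \<and>
         integrable M (up_fraction_at_hit S (int d)) \<and>
         integrable M (\<lambda>\<omega>. (up_fraction_at_hit S (int d) \<omega>)\<^sup>2) \<and>
         interval_lebesgue_integrable lborel 0 1 (\<lambda>u. u ^ (d - 1) * h p u) \<and>
         interval_lebesgue_integrable lborel 0 1 (\<lambda>u. u ^ (d - 1) * h p u * ell p u) \<and>
         prob_space.expectation M (up_fraction_at_hit S (int d)) =
           1 / 2 + real d / 2 * (LBINT u=0..1. u ^ (d - 1) * h p u) \<and>
         prob_space.variance M (up_fraction_at_hit S (int d)) =
           (real d)\<^sup>2 / 4 *
             ((LBINT u=0..1. u ^ (d - 1) * h p u * ell p u) -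
              (LBINT u=0..1. u ^ (d - 1) * h p u)\<^sup>2)"
proof -
  interpret prob_space M
    using assms(4) by (simp add: simple_random_walk_def)
  interpret upward_walk M p S d
    using assms by unfold_locales (auto simp: simple_random_walk_def)
  have "AE \<omega> in M. hitting_time S (int d) \<omega> \<noteq> \<infinity>"
    using AE_hit by eventually_elim (simp add: hitting_time_eq)
  then show ?thesis
    using up_fraction_moments moments_of_inverse_T by simp
qed

end
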